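(* Let $L=\operatorname{arsinh}1=\log(1+\sqrt2)$. For every integer $m\ge0$ and $\operatorname{Re}s>-1$, $$\sum_{r=0}^{\infty}\frac{\binom{4r}{2r}}{16^r}\frac{t_{2r}(\{2\}^m)}{4r+s+1}=\frac1{2(2m)!}\left\{\int_0^{\pi/2}\theta^{2m}\sin^s\theta\,d\theta+(-1)^m\int_0^Lt^{2m}\sinh^st\,dt\right\},$$ $$\sum_{r=0}^{\infty}\frac{\binom{4r+2}{2r+1}}{2^{4r+2}}\frac{t_{2r+1}(\{2\}^m)}{4r+s+3}=\frac1{2(2m)!}\left\{\int_0^{\pi/2}\theta^{2m}\sin^s\theta\,d\theta-(-1)^m\int_0^Lt^{2m}\sinh^st\,dt\right\}.$$ For every integer $m\ge1$ and $\operatorname{Re}s>-2$, $$\sum_{r=1}^{\infty}\frac{16^r}{r\binom{4r}{2r}}\frac{\zeta_{2r-1}(\{2\}^{m-1})}{4r+s}=\frac{2^{2m-1}}{(2m-1)!}\left\{\int_0^{\pi/2}\theta^{2m-1}\sin^s\theta\,d\theta+(-1)^m\int_0^Lt^{2m-1}\sinh^st\,dt\right\},$$ $$\sum_{r=0}^{\infty}\frac{2\cdot4^{2r+1}}{(2r+1)\binom{4r+2}{2r+1}}\frac{\zeta_{2r}(\{2\}^{m-1})}{4r+s+2}=\frac{2^{2m-1}}{(2m-1)!}\left\{\int_0^{\pi/2}\theta^{2m-1}\sin^s\theta\,d\theta-(-1)^m\int_0^Lt^{2m-1}\sinh^st\,dt\right\}.$$ The identities are locally uniform in $s$ (the series converge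 uniformly) on compact subsets of the indicated half-planes, and fixed finite derivatives with respect to $s$ may be taken term by term.
   Context: For integers $n\ge0$, $m\ge0$, the finite repeated-$2$ sums are $$\zeta_n(\{2\}^m):=\sum_{n\ge n_1>\cdots>n_m\ge1}\frac1{n_1^2\cdots n_m^2},\qquad t_n(\{2\}^m):=\sum_{n\ge n_1>\cdots>n_m\ge1}\frac1{(2n_1-1)^2\cdots(2n_m-1)^2},$$ with the value $1$ when $m=0$ and the value $0$ when $m>n$. Here $s\in\mathbb C$. *)

theory Defs
  imports "HOL-Complex_Analysis.Complex_Analysis"
begin

definition decreasing_tuples :: "nat \<Rightarrow> nat \<Rightarrow> nat list set" where
  "decreasing_tuples n m = {ns. length ns = m \<and> sorted_wrt (>) ns \<and> set ns \<subseteq> {1..n}}"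

definition zeta_two :: "nat \<Rightarrow> nat \<Rightarrow> real" where
  "zeta_two n m = (\<Sum>ns\<in>decreasing_tuples n m. \<Prod>i<m. 1 / (real (ns ! i))\<^sup>2)"

definition t_two :: "nat \<Rightarrow> nat \<Rightarrow> real" where
  "t_two n m = (\<Sum>ns\<in>decreasing_tuples n m. \<Prod>i<m. 1 / (2 * real (ns ! i) - 1)\<^sup>2)"

lemma finite_decreasing_tuples: "finite (decreasing_tuples n m)"
  by (rule finite_subset[OF _ finite_lists_length_eq[of "{1..n}" m]])
     (auto simp: decreasing_tuples_def)

lemma decreasing_tuples_0: "decreasing_tuples n 0 = {[]}"
  by (auto simp: decreasing_tuples_def)

lemma decreasing_tuples_empty:
  assumes "m > n"
  shows "decreasing_tuples n m = {}"
proof -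
  have "length ns \<le> n" if "sorted_wrt (>) ns" "set ns \<subseteq> {1..n}" for ns :: "nat list"
  proof -
    have "distinct ns"
      using that(1) by (induction ns) auto
    then have "length ns = card (set ns)"
      by (simp add: distinct_card)
    also have "\<dots> \<le> card {1..n}"
      using that(2) by (intro card_mono) auto
    finally show ?thesis by simp
  qed
  then show ?thesis
    using assms by (force simp: decreasing_tuples_def)
qed

lemma two_sums_0: "zeta_two n 0 = 1" "t_two n 0 = 1"
  by (simp_all add: zeta_two_def t_two_def decreasing_tuples_0)

lemma two_sums_eq_0: "m > n \<Longrightarrow> zeta_two n m = 0" "m > n \<Longrightarrow> t_two n m = 0"
  by (simp_all add: zeta_two_def t_two_def decreasing_tuples_empty)

text \<open>
  The identity \<open>(\<Sum>r\<ge>r\<^sub>0. f r s) = F s\<close> on an open set \<open>H\<close>, with uniform convergence on the compact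
  subsets of \<open>H\<close> and termwise differentiation to every finite order. Since \<open>deriv\<close> is total,
  holomorphy of the terms and of the sum is required explicitly, so that the iterated derivatives
  are genuine ones.
\<close>
definition locally_uniform_series ::
    "complex set \<Rightarrow> nat \<Rightarrow> (nat \<Rightarrow> complex \<Rightarrow> complex) \<Rightarrow> (complex \<Rightarrow> complex) \<Rightarrow> bool" where
  "locally_uniform_series H r\<^sub>0 f F \<longleftrightarrow>
     (\<forall>s\<in>H. (\<lambda>r. f (r\<^sub>0 + r) s) sums F s) \<and>
     (\<forall>K. compact K \<and> K \<subseteq> H \<longrightarrow>
        uniform_limit K (\<lambda>N s. \<Sum>r<N. f (r\<^sub>0 + r) s) F sequentially) \<and>
     (\<forall>r\<ge>r\<^sub>0. f r holomorphic_on H) \<and> F holomorphic_on H \<and>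
     (\<forall>k. \<forall>s\<in>H. (\<lambda>r. (deriv ^^ k) (f (r\<^sub>0 + r)) s) sums (deriv ^^ k) F s)"

text \<open>
  The integrands of the two moments. For \<open>x > 0\<close> the power \<open>complex_of_real x powr s\<close> is
  \<open>exp (s * ln x)\<close>; the endpoint value \<open>0 powr s = 0\<close> does not affect the integrals.
\<close>
definition sin_integrand :: "nat \<Rightarrow> complex \<Rightarrow> real \<Rightarrow> complex" where
  "sin_integrand k s \<theta> = complex_of_real (\<theta> ^ k) * complex_of_real (sin \<theta>) powr s"

definition sinh_integrand :: "nat \<Rightarrow> complex \<Rightarrow> real \<Rightarrow> complex" where
  "sinh_integrand k s t = complex_of_real (t ^ k) * complex_of_real (sinh t) powr s"

end

theory Submission
  imports Defs
begin

text \<open>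
  For \<open>S z = z ^ k / k!\<close> write \<open>S z = cos z * g (sin z)\<close>. Since \<open>S'' = z ^ (k - 2) / (k - 2)!\<close>, the
  coefficients \<open>b\<^sub>j\<close> of the power series \<open>g\<close> satisfy a recurrence in \<open>j\<close> and \<open>k\<close>, solved up to elementary factors by a
  central binomial coefficient times \<open>t\<^sub>n\<close> (\<open>k\<close> even) or by its inverse times \<open>\<zeta>\<^sub>n\<close> (\<open>k\<close> odd). Taking \<open>z = \<theta>\<close> and
  \<open>z = \<i> t\<close>, multiplying by \<open>sin\<^sup>s \<theta>\<close> resp. \<open>sinh\<^sup>s t\<close> and integrating termwise with
  \<open>\<integral> cos \<theta> sin\<^sup>p \<theta> d\<theta> = 1 / (p + 1) = \<integral> cosh t sinh\<^sup>p t dt\<close> gives both moments as series in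
  \<open>b\<^sub>j / (j + s + 1)\<close>, with and without alternating signs; their half-sum and half-difference are the
  four identities. The recurrence also makes \<open>\<Sum> b\<^sub>j / (j + 2)\<close> telescope, and this one
  convergent series justifies the termwise integration and the Weierstrass test in \<open>s\<close>.
\<close>

subsection \<open>The expansion of powers of the inverse sine\<close>

text \<open>These are the Taylor coefficients at 0 of arcsin^k z / (k! sqrt (1 - z^2)). The
  recurrence couples \<open>k\<close> to \<open>k - 2\<close>, which is why \<open>k\<close> is an
  argument; for \<open>k < 2\<close> the coupling term is absent.\<close>

fun arcsin_coeff :: "nat \<Rightarrow> nat \<Rightarrow> real" where
  "arcsin_coeff k 0 = (if k = 0 then 1 else 0)"
| "arcsin_coeff k (Suc 0) = (if k = 1 then 1 else 0)"
| "arcsin_coeff k (Suc (Suc j)) =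
     ((real j + 1)\<^sup>2 * arcsin_coeff k j + (if k \<ge> 2 then arcsin_coeff (k - 2) j else 0)) /
     ((real j + 1) * (real j + 2))"

lemma arcsin_coeff_nonneg: "arcsin_coeff k j \<ge> 0"
  by (induction k j rule: arcsin_coeff.induct) auto

text \<open>The induction closes because (j + 1)^2 + 1 is smaller than or equal to (j + 1)(j + 2),
  the gap being j. The bound yields convergence in the unit disc and also controls the inhomogeneous
  term of the recurrence.\<close>

lemma arcsin_coeff_le_1: "arcsin_coeff k j \<le> 1"
proof (induction k j rule: arcsin_coeff.induct)
  case (3 k j)
  have "(real j + 1)\<^sup>2 * arcsin_coeff k j + (if k \<ge> 2 then arcsin_coeff (k - 2) j else 0)
          \<le> (real j + 1)\<^sup>2 * 1 + 1"
    using 3 by (intro add_mono mult_left_mono) auto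
  also have "\<dots> \<le> (real j + 1) * (real j + 2)"
    by (simp add: power2_eq_square algebra_simps)
  finally show ?case
    by (simp add: divide_le_eq)
qed auto

text \<open>The recurrence exhibits \<open>arcsin_coeff k j / (j + 2)\<close> as the telescoping difference
  \<open>arcsin_coeff k j - arcsin_coeff k (j + 2)\<close> plus a summable term.\<close>
lemma summable_arcsin_coeff_div: "summable (\<lambda>j. arcsin_coeff k j / (real j + 2))"
proof (rule summableI_nonneg_bounded)
  let ?b = "arcsin_coeff k"
  fix n
  have step: "?b j / (real j + 2) \<le> (?b j - ?b (Suc (Suc j))) + (1 / (real j + 1) - 1 / (real (Suc j) + 1))" for j
  proof -
    have "(if k \<ge> 2 then arcsin_coeff (k - 2) j else 0) \<le> 1"
      by (simp add: arcsin_coeff_le_1)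
    then have "?b (Suc (Suc j)) \<le> ((real j + 1)\<^sup>2 * ?b j + 1) / ((real j + 1) * (real j + 2))"
      by (auto intro!: divide_right_mono)
    \<comment> \<open>Uses (j + 1) / (j + 2) = 1 - 1 / (j + 2) and the partial fractions of 1 / ((j
      + 1)(j + 2)).\<close>
    also have "\<dots> = ?b j - ?b j / (real j + 2) + (1 / (real j + 1) - 1 / (real j + 2))"
      by (simp add: divide_simps power2_eq_square) (simp add: algebra_simps)
    finally show ?thesis
      by (simp add: algebra_simps)
  qed
  have "(\<Sum>j<n. ?b j / (real j + 2))
      \<le> (\<Sum>j<n. (?b j - ?b (Suc (Suc j))) + (1 / (real j + 1) - 1 / (real (Suc j) + 1)))"
    by (intro sum_mono step)
  also have "\<dots> = (?b 0 + ?b 1) - (?b n + ?b (Suc n)) + (1 - 1 / (real n + 1))"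
    by (induction n) auto
  \<comment> \<open>The two initial coefficients are at most 1 each, the telescoped fractions
    contribute at most 1, and the subtracted coefficients are nonnegative.\<close>
  also have "\<dots> \<le> 3"
    using arcsin_coeff_nonneg[of k n] arcsin_coeff_nonneg[of k "Suc n"]
      arcsin_coeff_le_1[of k 0] arcsin_coeff_le_1[of k 1]
    by (smt (verit) divide_nonneg_nonneg of_nat_0_le_iff)
  finally show "(\<Sum>j<n. ?b j / (real j + 2)) \<le> 3" .
qed (simp add: arcsin_coeff_nonneg)

text \<open>The recurrence lowers \<open>j\<close> by two and \<open>k\<close> by zero or two, so
  the parity of \<open>k + j\<close> is invariant, and the initial values vanish when it is odd.
  Hence all series can run over the indices \<open>2 * n + k mod 2\<close>.\<close>

lemma arcsin_coeff_parity: "odd (k + j) \<Longrightarrow> arcsin_coeff k j = 0"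
  by (induction k j rule: arcsin_coeff.induct) (auto simp: odd_pos)

section \<open>The generating series and its differential equation\<close>

definition arcsin_fps :: "nat \<Rightarrow> complex fps" where
  "arcsin_fps k = Abs_fps (\<lambda>j. of_real (arcsin_coeff k j))"

lemma summable_arcsin_coeff_power:
  assumes "0 \<le> x" "x < 1"
  shows   "summable (\<lambda>j. arcsin_coeff k j * x ^ j)"
proof (rule summable_comparison_test')
  show "summable (\<lambda>j. x ^ j)"
    using assms by (simp add: summable_geometric)
  show "norm (arcsin_coeff k j * x ^ j) \<le> x ^ j" if "j \<ge> 0" for j
    using assms arcsin_coeff_nonneg[of k j] arcsin_coeff_le_1[of k j]
    by (simp add: abs_mult mult_left_le_one_le)
qed

lemma fps_conv_radius_arcsin_fps: "fps_conv_radius (arcsin_fps k) \<ge> 1"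
  unfolding fps_conv_radius_def
proof (rule conv_radius_geI_ex')
  fix r :: real
  assume "0 < r" "ereal r < 1"
  then have "summable (\<lambda>j. complex_of_real (arcsin_coeff k j * r ^ j))"
    by (intro summable_of_real summable_arcsin_coeff_power) auto
  then show "summable (\<lambda>n. fps_nth (arcsin_fps k) n * complex_of_real r ^ n)"
    by (simp add: arcsin_fps_def)
qed

text \<open>With D the derivative, X^2 D^2 + 3 X D + 1 multiplies the coefficient of index n by n (n
  - 1) + 3 n + 1 = (n + 1)^2, so this is the recurrence read as an identity of generating
  series.\<close>

lemma arcsin_fps_ode:
  "fps_deriv (fps_deriv (arcsin_fps k)) =
     fps_X * (fps_X * fps_deriv (fps_deriv (arcsin_fps k))) + 3 * (fps_X * fps_deriv (arcsin_fps k)) + arcsin_fps k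
     + (if k \<ge> 2 then arcsin_fps (k - 2) else 0)"
proof (rule fps_ext)
  fix n
  define c :: "nat \<Rightarrow> complex" where "c j = of_real (arcsin_coeff k j)" for j
  define d :: complex where "d = (if k \<ge> 2 then of_real (arcsin_coeff (k - 2) n) else 0)"
  have "arcsin_coeff k (Suc (Suc n)) * ((real n + 1) * (real n + 2)) =
      (real n + 1)\<^sup>2 * arcsin_coeff k n + (if k \<ge> 2 then arcsin_coeff (k - 2) n else 0)"
    by simp
  then have "complex_of_real (arcsin_coeff k (Suc (Suc n)) * ((real n + 1) * (real n + 2))) =
      complex_of_real ((real n + 1)\<^sup>2 * arcsin_coeff k n + (if k \<ge> 2 then arcsin_coeff (k - 2) n else 0))"
    by (simp only:)
  then have rec: "(of_nat n + 1) * (of_nat n + 2) * c (Suc (Suc n)) = (of_nat n + 1)\<^sup>2 * c n + d"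
    by (simp add: c_def d_def mult_ac del: arcsin_coeff.simps split: if_splits)
  have nth: "fps_nth (arcsin_fps k) j = c j" for j
    by (simp add: arcsin_fps_def c_def)
  define T where "T = (if k \<ge> 2 then arcsin_fps (k - 2) else 0)"
  have T: "fps_nth T n = d"
    by (simp add: T_def d_def arcsin_fps_def)
  have "fps_nth (fps_X * (fps_X * fps_deriv (fps_deriv (arcsin_fps k)))) n = of_nat n * (of_nat n - 1) * c n"
  proof -
    \<comment> \<open>Multiplying by \<open>fps_X\<close> twice shifts by two; the indices 0 and 1
      that are not reached are those where the factor n (n - 1) vanishes.\<close>
    consider "n = 0" | "n = 1" | i where "n = Suc (Suc i)"
      by (metis One_nat_def not0_implies_Suc)
    then show ?thesis
      by cases (simp_all add: nth)
  qed
  moreover have "fps_nth (3 * (fps_X * fps_deriv (arcsin_fps k))) n = 3 * of_nat n * c n"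
    by (cases n) (simp_all add: nth numeral_fps_const)
  moreover have "fps_nth (fps_deriv (fps_deriv (arcsin_fps k))) n = (of_nat n + 1)\<^sup>2 * c n + d"
    using rec by (simp add: nth algebra_simps)
  ultimately have "fps_nth (fps_deriv (fps_deriv (arcsin_fps k))) n = fps_nth (fps_X * (fps_X * fps_deriv (fps_deriv (arcsin_fps k))) + 3 * (fps_X * fps_deriv (arcsin_fps k)) + arcsin_fps k
     + T) n"
    unfolding fps_add_nth by (simp add: nth T power2_eq_square algebra_simps)
  then show "fps_nth (fps_deriv (fps_deriv (arcsin_fps k))) n = fps_nth (fps_X * (fps_X * fps_deriv (fps_deriv (arcsin_fps k))) + 3 * (fps_X * fps_deriv (arcsin_fps k)) + arcsin_fps k
     + (if k \<ge> 2 then arcsin_fps (k - 2) else 0)) n"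
    by (simp only: T_def)
qed

text \<open>Formal derivatives, products with polynomials and sums do not shrink the disc of
  convergence below radius 1, so evaluation turns the formal equation into an analytic one on the
  unit disc.\<close>

lemma arcsin_fps_eval_ode:
  fixes z :: complex and k :: nat
  assumes "norm z < 1"
  defines "g \<equiv> eval_fps (arcsin_fps k)"
    and "g' \<equiv> eval_fps (fps_deriv (arcsin_fps k))"
    and "g'' \<equiv> eval_fps (fps_deriv (fps_deriv (arcsin_fps k)))"
  shows "(g has_field_derivative g' z) (at z)" "(g' has_field_derivative g'' z) (at z)"
    and "g'' z = z\<^sup>2 * g'' z + 3 * z * g' z + g z + (if k \<ge> 2 then eval_fps (arcsin_fps (k - 2)) z else 0)"
proof -
  have z: "ereal (norm z) < 1"
    using assms by simp
  have r0: "ereal (norm z) < fps_conv_radius (arcsin_fps i)" for i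
    using z fps_conv_radius_arcsin_fps[of i] by (rule less_le_trans)
  have r1: "ereal (norm z) < fps_conv_radius (fps_deriv (arcsin_fps k))"
    using r0[of k] fps_conv_radius_deriv[of "arcsin_fps k"] by (rule less_le_trans)
  have r2: "ereal (norm z) < fps_conv_radius (fps_deriv (fps_deriv (arcsin_fps k)))"
    using r1 fps_conv_radius_deriv by (rule less_le_trans)
  show "(g has_field_derivative g' z) (at z)" "(g' has_field_derivative g'' z) (at z)"
    unfolding g_def g'_def g''_def using r0 r1 by (auto intro!: has_field_derivative_eval_fps)
  have rX: "ereal (norm z) < fps_conv_radius (fps_X * F)" if "ereal (norm z) < fps_conv_radius F" for F :: "complex fps"
    using that by (auto intro!: less_le_trans[OF _ fps_conv_radius_mult])
  have r3: "ereal (norm z) < fps_conv_radius (3 * F)" if "ereal (norm z) < fps_conv_radius F" for F :: "complex fps"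
    using that by (auto intro!: less_le_trans[OF _ fps_conv_radius_mult])
  have ra: "ereal (norm z) < fps_conv_radius (F + G)"
    if "ereal (norm z) < fps_conv_radius F" "ereal (norm z) < fps_conv_radius G" for F G :: "complex fps"
    using that by (auto intro!: less_le_trans[OF _ fps_conv_radius_add])
  have rif: "ereal (norm z) < fps_conv_radius (if k \<ge> 2 then arcsin_fps (k - 2) else 0)"
    using r0 by auto
  have "g'' z = eval_fps (fps_X * (fps_X * fps_deriv (fps_deriv (arcsin_fps k))) + 3 * (fps_X * fps_deriv (arcsin_fps k)) + arcsin_fps k
     + (if k \<ge> 2 then arcsin_fps (k - 2) else 0)) z"
    unfolding g''_def using arcsin_fps_ode[of k] by metis
  also have "\<dots> = z\<^sup>2 * g'' z + 3 * z * g' z + g z + eval_fps (if k \<ge> 2 then arcsin_fps (k - 2) else 0) z"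
    unfolding g_def g'_def g''_def
    by (simp add: eval_fps_add eval_fps_mult ra rX r3 r0 r1 r2 rif power2_eq_square mult.assoc)
  finally show "g'' z = z\<^sup>2 * g'' z + 3 * z * g' z + g z + (if k \<ge> 2 then eval_fps (arcsin_fps (k - 2)) z else 0)"
    by (auto split: if_splits)
qed

text \<open>With \<open>S z = cos z * g (sin z)\<close> the differential equation of \<open>g\<close> becomes \<open>S'' = S\<^sub>k\<^sub>-\<^sub>2\<close>.\<close>
lemma arcsin_power_expansion:
  fixes X :: "complex set"
  assumes X: "convex X" "0 \<in> X" "\<And>z. z \<in> X \<Longrightarrow> norm (sin z) < 1"
    and z: "z \<in> X"
  shows "cos z * eval_fps (arcsin_fps k) (sin z) = z ^ k / fact k"
  using z
proof (induction k arbitrary: z rule: less_induct)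
  case (less k)
  define g where "g = eval_fps (arcsin_fps k)"
  define g' where "g' = eval_fps (fps_deriv (arcsin_fps k))"
  define g'' where "g'' = eval_fps (fps_deriv (fps_deriv (arcsin_fps k)))"
  define S' where "S' = (\<lambda>z. (cos z)\<^sup>2 * g' (sin z) - sin z * g (sin z))"
  \<comment> \<open>\<open>p\<close> and \<open>q\<close> are the first and second derivatives of
    z^k / k!; the case distinctions guard the truncated subtractions.\<close>
  define p where "p = (\<lambda>z::complex. if k = 0 then 0 else z ^ (k - 1) / fact (k - 1))"
  define q where "q = (\<lambda>z::complex. if k \<ge> 2 then z ^ (k - 2) / fact (k - 2) else 0)"
  note ode = arcsin_fps_eval_ode[where k = k, folded g_def g'_def g''_def]
  have dg: "(g has_field_derivative g' (sin z)) (at (sin z))"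
    and dg': "(g' has_field_derivative g'' (sin z)) (at (sin z))" if "z \<in> X" for z
    using ode(1,2) X(3)[OF that] by auto
  \<comment> \<open>Derivatives are taken within \<open>X\<close> because \<open>X\<close> will be a
    line segment, which is not open in the complex plane.\<close>
  have dgs: "((\<lambda>z. g (sin z)) has_field_derivative g' (sin z) * cos z) (at z within X)"
    and dgs': "((\<lambda>z. g' (sin z)) has_field_derivative g'' (sin z) * cos z) (at z within X)" if "z \<in> X" for z
    by (rule DERIV_chain2[where g = sin, OF dg[OF that] DERIV_subset[OF DERIV_sin subset_UNIV]]
             DERIV_chain2[where g = sin, OF dg'[OF that] DERIV_subset[OF DERIV_sin subset_UNIV]])+
  have dS: "((\<lambda>z. cos z * g (sin z)) has_field_derivative S' z) (at z within X)" if "z \<in> X" for z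
    by (rule derivative_eq_intros dgs that refl)+
       (simp add: S'_def power2_eq_square algebra_simps)
  have pow: "((\<lambda>z::complex. z ^ Suc i / fact (Suc i)) has_field_derivative z ^ i / fact i) (at z within X)" for z i
    by (rule DERIV_cong[OF DERIV_cdivide[OF DERIV_power[OF DERIV_ident]]]) (simp del: of_nat_Suc)
  have dp: "((\<lambda>z. z ^ k / fact k) has_field_derivative p z) (at z within X)" for z
    using pow[where i = "k - 1"] by (cases k) (simp_all add: p_def)
  have dq: "(p has_field_derivative q z) (at z within X)" for z
  proof -
    consider "k = 0" | "k = 1" | i where "k = Suc (Suc i)"
      by (metis One_nat_def not0_implies_Suc)
    then show ?thesis
      using pow[where i = "k - 2"] by cases (simp_all add: p_def q_def)
  qed
  have dS': "(S' has_field_derivative q z) (at z within X)" if "z \<in> X" for z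
  proof -
    have "(S' has_field_derivative
        (cos z * ((cos z)\<^sup>2 * g'' (sin z) - 3 * sin z * g' (sin z) - g (sin z)))) (at z within X)"
      unfolding S'_def
      by (rule derivative_eq_intros dgs dgs' that refl)+
         (simp add: power2_eq_square algebra_simps)
    \<comment> \<open>Replacing cos^2 by 1 - sin^2 makes the bracket the differential operator of
      \<open>g\<close> at sin z. The induction hypothesis for \<open>k - 2\<close> then evaluates
      the remaining right-hand side.\<close>
    also have "(cos z)\<^sup>2 * g'' (sin z) - 3 * sin z * g' (sin z) - g (sin z) =
        (if k \<ge> 2 then eval_fps (arcsin_fps (k - 2)) (sin z) else 0)"
      using ode(3)[OF X(3)[OF that]] by (simp add: cos_squared_eq algebra_simps)
    also have "cos z * \<dots> = q z"
      using less.IH[of "k - 2" z] that by (auto simp: q_def)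
    finally show ?thesis .
  qed
  \<comment> \<open>Two integrations from 0 follow. The constants vanish because at 0 both
    \<open>S'\<close> and \<open>p\<close> take the value \<open>arcsin_coeff k 1\<close>, and
    afterwards both functions take the value \<open>arcsin_coeff k 0\<close>.\<close>
  have "\<exists>c. \<forall>z\<in>X. S' z - p z = c"
    by (rule has_field_derivative_zero_constant[OF X(1)])
       (use dS' dq in \<open>auto intro!: derivative_eq_intros\<close>)
  moreover have "S' 0 - p 0 = 0"
    by (cases k) (auto simp: S'_def p_def g'_def eval_fps_at_0 arcsin_fps_def)
  ultimately have S'p: "S' z = p z" if "z \<in> X" for z
    using X(2) that by (metis right_minus_eq)
  have "\<exists>c. \<forall>z\<in>X. cos z * g (sin z) - z ^ k / fact k = c"
    by (rule has_field_derivative_zero_constant[OF X(1)], rule derivative_eq_intros, erule dS, rule dp)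
       (simp add: S'p)
  moreover have "cos 0 * g (sin 0) - 0 ^ k / fact k = 0"
    by (cases k) (auto simp: g_def eval_fps_at_0 arcsin_fps_def)
  ultimately show ?case
    using X(2) less.prems unfolding g_def by (metis right_minus_eq)
qed

subsection \<open>Moments of power series in a monotone substitution\<close>

text \<open>Common abstraction of \<open>sin\<close> on [0, pi/2] and \<open>sinh\<close> on
  [0, arsinh 1]: \<open>v\<close> runs from 0 to 1, and the weight \<open>v'\<close> turns each
  power of \<open>v\<close> into an exact derivative.\<close>

locale increasing_substitution =
  fixes v v' :: "real \<Rightarrow> real" and B :: real
  assumes B_pos: "B > 0"
    and v_0: "v 0 = 0" and v_B: "v B = 1"
    and v_deriv: "(v has_real_derivative v' x) (at x)"
    and v'_cont: "isCont v' x"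
    and v_pos: "0 < x \<Longrightarrow> x < B \<Longrightarrow> 0 < v x"
    and v'_nonneg: "0 < x \<Longrightarrow> x < B \<Longrightarrow> 0 \<le> v' x"
begin

lemma v_cont: "isCont v x"
  using v_deriv by (rule DERIV_isCont)

lemma v_tendsto: "(v \<longlongrightarrow> 0) (at_right 0)" "(v \<longlongrightarrow> 1) (at_left B)"
proof -
  have "(v \<longlongrightarrow> v x) (at x within A)" for x A
    using v_cont[of x] unfolding isCont_def by (rule tendsto_within_subset) simp
  from this[of 0 "{0<..}"] this[of B "{..<B}"]
  show "(v \<longlongrightarrow> 0) (at_right 0)" "(v \<longlongrightarrow> 1) (at_left B)"
    by (simp_all add: v_0 v_B)
qed

lemma eventually_v_pos: "eventually (\<lambda>x. 0 < v x) (at_right 0)"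
  using eventually_at_right_real[OF B_pos] by eventually_elim (auto intro: v_pos)

text \<open>The antiderivative v^(\<sigma> + 1) / (\<sigma> + 1) tends to 0 at the left end because
  \<sigma> + 1 > 0. Since the integrand is nonnegative, the fundamental theorem also yields
  integrability, although the integrand may be unbounded near 0.\<close>

lemma real_power_integral:
  assumes "\<sigma> > -1"
  shows "set_integrable lborel {0<..<B} (\<lambda>x. v' x * v x powr \<sigma>)"
    and "(LBINT x:{0<..<B}. v' x * v x powr \<sigma>) = 1 / (\<sigma> + 1)"
proof -
  let ?F = "\<lambda>x. v x powr (\<sigma> + 1) / (\<sigma> + 1)"
  have D: "(?F has_real_derivative v' x * v x powr \<sigma>) (at x)" if "0 < x" "x < B" for x
    using assms v_pos[OF that] by (auto intro!: derivative_eq_intros v_deriv)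
  have C: "isCont (\<lambda>x. v' x * v x powr \<sigma>) x" if "0 < x" "x < B" for x
    using v_pos[OF that] by (auto intro!: continuous_intros v_cont v'_cont)
  have "((\<lambda>x. v x powr (\<sigma> + 1)) \<longlongrightarrow> 0) (at_right 0)"
    using assms eventually_v_pos
    by (intro tendsto_zero_powrI[OF v_tendsto(1) tendsto_const]) (auto elim: eventually_mono)
  then have l0: "(?F \<longlongrightarrow> 0) (at_right 0)"
    using tendsto_divide[OF _ tendsto_const, of _ 0 _ "\<sigma> + 1"] assms by simp
  have lB: "(?F \<longlongrightarrow> 1 / (\<sigma> + 1)) (at_left B)"
    using assms by (auto intro!: tendsto_eq_intros v_tendsto)
  have "einterval (ereal 0) (ereal B) = {0<..<B}"
    by (auto simp: einterval_def)
  note FTC = interval_integral_FTC_nonneg[of "ereal 0" "ereal B" ?F "\<lambda>x. v' x * v x powr \<sigma>" 0 "1 / (\<sigma> + 1)",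
      unfolded this ereal_tendsto_simps1]
  have nn: "AE x in lborel. ereal 0 < ereal x \<longrightarrow> ereal x < ereal B \<longrightarrow> 0 \<le> v' x * v x powr \<sigma>"
    using v'_nonneg by (intro AE_I2) auto
  show "set_integrable lborel {0<..<B} (\<lambda>x. v' x * v x powr \<sigma>)"
    by (rule FTC(1)) (use B_pos D C nn l0 lB in auto)
  have "interval_lebesgue_integral lborel (ereal 0) (ereal B) (\<lambda>x. v' x * v x powr \<sigma>) = 1 / (\<sigma> + 1) - 0"
    by (rule FTC(2)) (use B_pos D C nn l0 lB in auto)
  then show "(LBINT x:{0<..<B}. v' x * v x powr \<sigma>) = 1 / (\<sigma> + 1)"
    using B_pos by (simp add: interval_lebesgue_integral_def)
qed

text \<open>The real case with exponent \<open>Re p\<close> is exactly the norm of the integrand and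
  serves as its dominating function. The exact integral of the norm is what termwise integration
  requires later.\<close>

lemma complex_power_integral:
  fixes p :: complex
  assumes p: "Re p > -1"
  defines "h \<equiv> \<lambda>x. complex_of_real (v' x) * complex_of_real (v x) powr p"
  shows "set_integrable lborel {0<..<B} h"
    and "(LBINT x:{0<..<B}. h x) = 1 / (p + 1)"
    and "(LBINT x:{0<..<B}. norm (h x)) = 1 / (Re p + 1)"
proof -
  have norm_h: "norm (h x) = v' x * v x powr Re p" if "x \<in> {0<..<B}" for x
    using that v_pos[of x] v'_nonneg[of x] by (simp add: h_def norm_mult norm_powr_real_powr)
  show "(LBINT x:{0<..<B}. norm (h x)) = 1 / (Re p + 1)"
    using real_power_integral(2)[OF p] norm_h
    by (subst set_lebesgue_integral_cong[where g = "\<lambda>x. v' x * v x powr Re p"]) auto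
  have C: "isCont h x" if "0 < x" "x < B" for x
    using v_pos[OF that] unfolding h_def
    by (intro continuous_intros v_cont v'_cont continuous_powr_complex) auto
  have "continuous_on {0<..<B} h"
    using C by (intro continuous_at_imp_continuous_on) auto
  then have meas: "set_borel_measurable lborel {0<..<B} h"
    unfolding set_borel_measurable_def using borel_measurable_continuous_on_indicator[of "{0<..<B}" h] by simp
  show int: "set_integrable lborel {0<..<B} h"
    unfolding set_integrable_def
  proof (rule Bochner_Integration.integrable_bound)
    show "integrable lborel (\<lambda>x. indicat_real {0<..<B} x *\<^sub>R (v' x * v x powr Re p))"
      using real_power_integral(1)[OF p] by (simp add: set_integrable_def)
    show "AE x in lborel. norm (indicat_real {0<..<B} x *\<^sub>R h x) \<le> norm (indicat_real {0<..<B} x *\<^sub>R (v' x * v x powr Re p))"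
      using norm_h by (intro AE_I2) (auto split: split_indicator)
  qed (use meas in \<open>simp add: set_borel_measurable_def\<close>)
  let ?F = "\<lambda>x. complex_of_real (v x) powr (p + 1) / (p + 1)"
  have p1: "p + 1 \<noteq> 0"
    using p by (auto simp: complex_eq_iff)
  \<comment> \<open>Positivity of \<open>v x\<close> keeps the path off the branch cut of the
    complex power.\<close>
  have D: "(?F has_vector_derivative h x) (at x)" if "0 < x" "x < B" for x
  proof -
    have "((\<lambda>z. z powr (p + 1) / (p + 1)) has_field_derivative of_real (v x) powr p) (at (of_real (v x)))"
      using v_pos[OF that] p1 by (auto intro!: derivative_eq_intros)
    moreover have "((\<lambda>x. complex_of_real (v x)) has_vector_derivative complex_of_real (v' x)) (at x)"
      using v_deriv[of x] by (intro has_vector_derivative_of_real) (simp add: has_real_derivative_iff_has_vector_derivative)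
    ultimately show ?thesis
      unfolding h_def by (auto dest: field_vector_diff_chain_at simp: o_def)
  qed
  have "((\<lambda>x. v x powr (Re p + 1)) \<longlongrightarrow> 0) (at_right 0)"
    using p eventually_v_pos
    by (intro tendsto_zero_powrI[OF v_tendsto(1) tendsto_const]) (auto elim: eventually_mono)
  then have "((\<lambda>x. norm (complex_of_real (v x) powr (p + 1))) \<longlongrightarrow> 0) (at_right 0)"
    by (rule Lim_transform_eventually)
       (use eventually_v_pos in \<open>eventually_elim, simp add: norm_powr_real_powr\<close>)
  then have "((\<lambda>x. complex_of_real (v x) powr (p + 1)) \<longlongrightarrow> 0) (at_right 0)"
    by (rule tendsto_norm_zero_cancel)
  then have l0: "(?F \<longlongrightarrow> 0) (at_right 0)"
    using tendsto_divide[OF _ tendsto_const, of _ 0 _ "p + 1"] p1 by simp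
  have lB: "(?F \<longlongrightarrow> 1 / (p + 1)) (at_left B)"
  proof -
    have "((\<lambda>x. complex_of_real (v x)) \<longlongrightarrow> complex_of_real 1) (at_left B)"
      by (intro tendsto_of_real v_tendsto)
    then have "((\<lambda>x. complex_of_real (v x) powr (p + 1)) \<longlongrightarrow> complex_of_real 1 powr (p + 1)) (at_left B)"
      by (intro tendsto_powr_complex tendsto_const) auto
    from tendsto_divide[OF this tendsto_const, of "p + 1"] show ?thesis
      using p1 by simp
  qed
  have ei: "einterval (ereal 0) (ereal B) = {0<..<B}"
    by (auto simp: einterval_def)
  note FTC = interval_integral_FTC_integrable[of "ereal 0" "ereal B" ?F h 0 "1 / (p + 1)",
      unfolded ei ereal_tendsto_simps1]
  have "interval_lebesgue_integral lborel (ereal 0) (ereal B) h = 1 / (p + 1) - 0"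
    by (rule FTC) (use B_pos D C int l0 lB in auto)
  then show "(LBINT x:{0<..<B}. h x) = 1 / (p + 1)"
    using B_pos by (simp add: interval_lebesgue_integral_def ei)
qed

text \<open>Sum and integral may be exchanged because the integrals of the norms,
  \<open>norm (d n) / (real (e n) + Re s + 1)\<close>, are summable. Each power of \<open>v\<close>
  is merged with \<open>v powr s\<close> first, so only \<open>e n + Re s\<close> has to exceed -1;
  a series starting at exponent 1 thus reaches the half-plane Re s > -2.\<close>

lemma power_series_moment:
  fixes d :: "nat \<Rightarrow> complex" and e :: "nat \<Rightarrow> nat" and s :: complex and f g :: "real \<Rightarrow> complex"
  assumes e: "\<And>n. real (e n) + Re s > -1"
    and g: "\<And>x. 0 < x \<Longrightarrow> x < B \<Longrightarrow> (\<lambda>n. d n * of_real (v x) ^ e n) sums g x"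
    and abs: "\<And>x. 0 < x \<Longrightarrow> x < B \<Longrightarrow> summable (\<lambda>n. norm (d n) * v x ^ e n)"
    and d: "summable (\<lambda>n. norm (d n) / (real (e n) + Re s + 1))"
    and f: "\<And>x. 0 < x \<Longrightarrow> x < B \<Longrightarrow> f x = of_real (v' x) * g x * of_real (v x) powr s"
  shows "set_integrable lborel {0..B} f"
    and "(\<lambda>n. d n / (of_nat (e n) + s + 1)) sums (LBINT x:{0..B}. f x)"
proof -
  define h where "h n x = of_real (v' x) * of_real (v x) powr (of_nat (e n) + s)" for n x
  define H where "H n x = indicat_real {0<..<B} x *\<^sub>R (d n * h n x)" for n x
  have Re_e: "Re (of_nat (e n) + s) > -1" for n
    using e[of n] by simp
  note ci = complex_power_integral[OF Re_e, folded h_def]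
  have h_eq: "h n x = of_real (v' x) * of_real (v x) ^ e n * of_real (v x) powr s" if "x \<in> {0<..<B}" for n x
    using v_pos[of x] that by (simp add: h_def powr_add powr_nat')
  have H_eq: "H n = (\<lambda>x. d n * (indicat_real {0<..<B} x *\<^sub>R h n x))" for n
    by (simp add: H_def fun_eq_iff)
  have H_int: "integrable lborel (H n)" for n
    unfolding H_eq using ci(1)[of n] by (intro integrable_mult_right) (simp add: set_integrable_def)
  have H_val: "integral\<^sup>L lborel (H n) = d n / (of_nat (e n) + s + 1)" for n
    unfolding H_eq integral_mult_right_zero using ci(2)[of n] by (simp add: set_lebesgue_integral_def)
  have H_norm: "(\<integral>x. norm (H n x) \<partial>lborel) = norm (d n) / (real (e n) + Re s + 1)" for n
  proof -
    have "norm (H n x) = norm (d n) * (indicat_real {0<..<B} x *\<^sub>R norm (h n x))" for x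
      by (simp add: H_def norm_mult split: split_indicator)
    then show ?thesis
      using ci(3)[of n] by (simp add: set_lebesgue_integral_def)
  qed
  have H_sums: "(\<lambda>n. H n x) sums (indicat_real {0<..<B} x *\<^sub>R f x)" for x
  proof (cases "x \<in> {0<..<B}")
    case True
    have "(\<lambda>n. of_real (v' x) * (d n * of_real (v x) ^ e n) * of_real (v x) powr s) sums
        (of_real (v' x) * g x * of_real (v x) powr s)"
      using True by (intro sums_mult sums_mult2 g) auto
    moreover have "H n x = of_real (v' x) * (d n * of_real (v x) ^ e n) * of_real (v x) powr s" for n
      using True by (simp add: H_def h_eq)
    ultimately show ?thesis
      using True by (simp add: f)
  qed (simp add: H_def)
  have H_abs: "summable (\<lambda>n. norm (H n x))" for x
  proof (cases "x \<in> {0<..<B}")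
    case True
    have "norm (H n x) = v' x * (norm (d n) * v x ^ e n) * v x powr Re s" for n
      using True v_pos[of x] v'_nonneg[of x]
      by (simp add: H_def h_eq norm_mult norm_power norm_powr_real_powr)
    then show ?thesis
      using True abs[of x] by (auto intro!: summable_mult summable_mult2)
  qed (simp add: H_def)
  have sum: "summable (\<lambda>n. \<integral>x. norm (H n x) \<partial>lborel)"
    using d by (simp add: H_norm)
  note I = integrable_suminf[OF H_int AE_I2[OF H_abs] sum] sums_integral[OF H_int AE_I2[OF H_abs] sum]
  have "(\<lambda>x. \<Sum>n. H n x) = (\<lambda>x. indicat_real {0<..<B} x *\<^sub>R f x)"
    using H_sums by (simp add: sums_iff fun_eq_iff)
  note I = I[unfolded this H_val]
  \<comment> \<open>The endpoints form a null set, so neither the convention for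
    \<open>0 powr s\<close> nor the lack of convergence at \<open>v B = 1\<close> matters.\<close>
  have eq: "integrable lborel (\<lambda>x. indicat_real {0..B} x *\<^sub>R f x) \<longleftrightarrow> integrable lborel (\<lambda>x. indicat_real {0<..<B} x *\<^sub>R f x)"
    by (rule integrable_discrete_difference[where X = "{0, B}"]) (auto split: split_indicator)
  have eq': "(\<integral>x. indicat_real {0..B} x *\<^sub>R f x \<partial>lborel) = (\<integral>x. indicat_real {0<..<B} x *\<^sub>R f x \<partial>lborel)"
    by (rule integral_discrete_difference[where X = "{0, B}"]) (auto split: split_indicator)
  show "set_integrable lborel {0..B} f"
    using I(1) eq by (simp add: set_integrable_def)
  show "(\<lambda>n. d n / (of_nat (e n) + s + 1)) sums (LBINT x:{0..B}. f x)"
    using I(2) eq' by (simp add: set_lebesgue_integral_def)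
qed

end

section \<open>The circular and the hyperbolic substitution\<close>

interpretation sin_substitution: increasing_substitution sin cos "pi / 2"
proof
  show "(sin has_real_derivative cos x) (at x)" for x :: real
    by (rule DERIV_sin)
  show "isCont cos x" for x :: real
    by (rule isCont_cos)
  show "0 < sin x" "0 \<le> cos x" if "0 < x" "x < pi / 2" for x
    using that pi_gt_zero by (auto intro!: sin_gt_zero cos_ge_zero)
qed auto

interpretation sinh_substitution: increasing_substitution sinh cosh "arsinh (1::real)"
proof
  show "(sinh has_real_derivative cosh x) (at x)" for x :: real
    by (auto intro!: derivative_eq_intros)
  show "isCont cosh x" for x :: real
    by (intro continuous_intros)
  show "0 < sinh x" if "0 < x" for x :: real
    using that by simp
  show "0 < arsinh (1::real)"
    by simp
  show "sinh (arsinh 1) = (1::real)"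
    by (rule sinh_arsinh_real)
  show "0 \<le> cosh x" for x :: real
    by simp
qed simp

subsection \<open>Closed form of the coefficients\<close>

text \<open>Split by whether the largest admissible entry \<open>Suc n\<close> occurs; in a
  decreasing tuple it can only be the head.\<close>

lemma decreasing_tuples_Suc:
  "decreasing_tuples (Suc n) (Suc m) =
     decreasing_tuples n (Suc m) \<union> (#) (Suc n) ` decreasing_tuples n m"
proof (intro equalityI subsetI)
  fix ns
  assume ns: "ns \<in> decreasing_tuples (Suc n) (Suc m)"
  then obtain x xs where x: "ns = x # xs"
    by (cases ns) (auto simp: decreasing_tuples_def)
  show "ns \<in> decreasing_tuples n (Suc m) \<union> (#) (Suc n) ` decreasing_tuples n m"
    using ns unfolding x by (cases "x = Suc n") (fastforce simp: decreasing_tuples_def)+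
qed (fastforce simp: decreasing_tuples_def)

lemma sum_decreasing_tuples_Suc:
  fixes w :: "nat \<Rightarrow> 'a :: comm_semiring_1"
  shows "(\<Sum>ns\<in>decreasing_tuples (Suc n) (Suc m). \<Prod>i<Suc m. w (ns ! i)) =
    (\<Sum>ns\<in>decreasing_tuples n (Suc m). \<Prod>i<Suc m. w (ns ! i)) +
    w (Suc n) * (\<Sum>ns\<in>decreasing_tuples n m. \<Prod>i<m. w (ns ! i))"
proof -
  have "decreasing_tuples n (Suc m) \<inter> (#) (Suc n) ` decreasing_tuples n m = {}"
    by (auto simp: decreasing_tuples_def)
  moreover have "(\<Sum>ns\<in>(#) (Suc n) ` decreasing_tuples n m. \<Prod>i<Suc m. w (ns ! i)) =
      w (Suc n) * (\<Sum>ns\<in>decreasing_tuples n m. \<Prod>i<m. w (ns ! i))"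
    by (subst sum.reindex) (auto simp: prod.lessThan_Suc_shift sum_distrib_left simp del: prod.lessThan_Suc)
  ultimately show ?thesis
    unfolding decreasing_tuples_Suc
    by (subst sum.union_disjoint) (auto simp: finite_decreasing_tuples)
qed

lemma t_two_Suc: "t_two (Suc n) (Suc m) = t_two n (Suc m) + t_two n m / (2 * real n + 1)\<^sup>2"
  using sum_decreasing_tuples_Suc[where w = "\<lambda>j. 1 / (2 * real j - 1)\<^sup>2" and n = n and m = m]
  by (simp add: t_two_def algebra_simps)

lemma zeta_two_Suc: "zeta_two (Suc n) (Suc m) = zeta_two n (Suc m) + zeta_two n m / (real n + 1)\<^sup>2"
  using sum_decreasing_tuples_Suc[where w = "\<lambda>j. 1 / (real j)\<^sup>2" and n = n and m = m]
  by (simp add: zeta_two_def algebra_simps)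

lemma Suc_times_central_binomial:
  "(real n + 1) * real ((2 * Suc n) choose Suc n) = 2 * (2 * real n + 1) * real ((2 * n) choose n)"
proof -
  have fact: "real ((2 * i) choose i) = fact (2 * i) / (fact i * fact i)" for i
    by (simp add: binomial_fact)
  have "fact (2 * Suc n) = (2 * real n + 2) * ((2 * real n + 1) * fact (2 * n))"
    by (simp add: algebra_simps)
  then show ?thesis
    unfolding fact by (simp add: divide_simps) (simp add: algebra_simps)
qed

text \<open>The prefactor a_n satisfies a_(n+1) = (2n + 1) / (2n + 2) a_n. Dividing the coefficient
  recurrence by a_(n+1) leaves exactly the recurrence \<open>t_two_Suc\<close>.\<close>

lemma arcsin_coeff_even:
  "arcsin_coeff (2 * m) (2 * n) = real ((2 * n) choose n) / 4 ^ n * t_two n m"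
proof (induction n arbitrary: m)
  case 0
  then show ?case
    by (cases m) (simp_all add: two_sums_0 two_sums_eq_0)
next
  case (Suc n)
  define a where "a = real ((2 * n) choose n) / 4 ^ n"
  have a: "real ((2 * Suc n) choose Suc n) / 4 ^ Suc n = (2 * real n + 1) / (2 * real n + 2) * a"
    using Suc_times_central_binomial[of n] unfolding a_def
    by (simp add: divide_simps) (simp add: algebra_simps)
  have nz: "2 * real n + 1 \<noteq> 0" "2 * real n + 2 \<noteq> 0"
    by (smt (verit) of_nat_0_le_iff)+
  have rec: "arcsin_coeff (2 * m) (2 * Suc n) =
      ((2 * real n + 1)\<^sup>2 * (a * t_two n m) + (if m \<ge> 1 then a * t_two n (m - 1) else 0)) /
      ((2 * real n + 1) * (2 * real n + 2))"
    using Suc.IH[of m] Suc.IH[of "m - 1"] by (auto simp: a_def right_diff_distrib')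
  show ?case
  proof (cases m)
    case 0
    then show ?thesis
      unfolding rec a using nz by (simp add: two_sums_0 power2_eq_square)
  next
    case (Suc i)
    have "((2 * real n + 1)\<^sup>2 * (a * t_two n m) + a * t_two n i) / ((2 * real n + 1) * (2 * real n + 2)) =
        (2 * real n + 1) / (2 * real n + 2) * a * (t_two n m + t_two n i / (2 * real n + 1)\<^sup>2)"
      using nz by (simp add: divide_simps power2_eq_square) (simp add: algebra_simps)
    then show ?thesis
      unfolding rec a by (simp add: Suc t_two_Suc)
  qed
qed

text \<open>Here the prefactor is multiplied by (2n + 2) / (2n + 3) at each step, and the increment
  carries 1 / (2n + 2)^2 instead of 1 / (n + 1)^2. The resulting 1/4 per level accounts for the
  power \<open>4 ^ m\<close>.\<close>

lemma arcsin_coeff_odd':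
  "arcsin_coeff (2 * m + 1) (2 * n + 1) = 4 ^ n / ((2 * real n + 1) * real ((2 * n) choose n)) * zeta_two n m / 4 ^ m"
proof (induction n arbitrary: m)
  case 0
  then show ?case
    by (cases m) (simp_all add: two_sums_0 two_sums_eq_0)
next
  case (Suc n)
  define u where "u = 4 ^ n / ((2 * real n + 1) * real ((2 * n) choose n))"
  have nz: "2 * real n + 2 \<noteq> 0" "2 * real n + 3 \<noteq> 0" "real n + 1 \<noteq> 0"
    by (smt (verit) of_nat_0_le_iff)+
  have nz': "2 * real n + 1 \<noteq> 0"
    by (smt (verit) of_nat_0_le_iff)
  define x where "x = real ((2 * Suc n) choose Suc n)"
  define y where "y = real ((2 * n) choose n)"
  have "y > 0"
    by (simp add: y_def)
  have x: "x = 2 * (2 * real n + 1) * y / (real n + 1)"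
    using Suc_times_central_binomial[of n, folded x_def y_def] nz(3) by (simp add: field_simps)
  have "4 ^ Suc n / ((2 * real (Suc n) + 1) * x) = (2 * real n + 2) / (2 * real n + 3) * u"
    unfolding x u_def y_def[symmetric] using nz nz' \<open>y > 0\<close> by (simp add: divide_simps) (simp add: algebra_simps)
  then have u: "4 ^ Suc n / ((2 * real (Suc n) + 1) * real ((2 * Suc n) choose Suc n)) = (2 * real n + 2) / (2 * real n + 3) * u"
    unfolding x_def .
  have rec: "arcsin_coeff (2 * m + 1) (2 * Suc n + 1) =
      ((2 * real n + 2)\<^sup>2 * (u * zeta_two n m / 4 ^ m) + (if m \<ge> 1 then u * zeta_two n (m - 1) / 4 ^ (m - 1) else 0)) /
      ((2 * real n + 2) * (2 * real n + 3))"
  proof -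
    \<comment> \<open>For \<open>m = 0\<close> the truncated subtraction would break this equation,
      but then the index 1 is below 2 and the coupling term is absent.\<close>
    have "2 * m + 1 - 2 = 2 * (m - 1) + 1" if "m \<ge> 1"
      using that by simp
    moreover have "real (2 * n + 1) + 1 = 2 * real n + 2" "real (2 * n + 1) + 2 = 2 * real n + 3"
      by simp_all
    moreover have "arcsin_coeff (2 * m + 1) (2 * Suc n + 1) = arcsin_coeff (2 * m + 1) (Suc (Suc (2 * n + 1)))"
      by simp
    ultimately show ?thesis
      using Suc.IH[of m] Suc.IH[of "m - 1"] unfolding arcsin_coeff.simps(3) u_def by (auto simp: add.commute)
  qed
  show ?case
  proof (cases m)
    case 0
    then show ?thesis
      unfolding rec u using nz by (simp add: two_sums_0 power2_eq_square)
  next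
    case (Suc i)
    have "((2 * real n + 2)\<^sup>2 * (u * zeta_two n m / 4 ^ m) + u * zeta_two n i / 4 ^ i) / ((2 * real n + 2) * (2 * real n + 3)) =
        (2 * real n + 2) / (2 * real n + 3) * u * (zeta_two n m + zeta_two n i / (real n + 1)\<^sup>2) / 4 ^ m"
      unfolding Suc using nz by (simp add: divide_simps power2_eq_square) (simp add: algebra_simps)
    then show ?thesis
      unfolding rec u by (simp add: Suc zeta_two_Suc)
  qed
qed

text \<open>Passing to the next central binomial coefficient brings the closed form to the shape of
  the zeta identities, with \<open>Suc n\<close> as the index of the binomial.\<close>

lemma arcsin_coeff_odd:
  "4 ^ Suc m * arcsin_coeff (2 * m + 1) (2 * n + 1) =
     2 * 4 ^ Suc n / (real (Suc n) * real ((2 * Suc n) choose Suc n)) * zeta_two n m"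
proof -
  have "real (Suc n) * real ((2 * Suc n) choose Suc n) = 2 * ((2 * real n + 1) * real ((2 * n) choose n))"
    using Suc_times_central_binomial[of n] by (simp add: algebra_simps)
  then show ?thesis
    unfolding arcsin_coeff_odd' by simp
qed

subsection \<open>Locally uniform convergence\<close>

text \<open>Reduces the claim to one summable majorant per compact set: the M-test gives uniform
  convergence, locally uniform limits of holomorphic functions are holomorphic, and their
  derivatives of every order converge as well.\<close>

lemma locally_uniform_seriesI:
  assumes H: "open H"
    and hol: "\<And>r. f (r\<^sub>0 + r) holomorphic_on H"
    and sums: "\<And>s. s \<in> H \<Longrightarrow> (\<lambda>r. f (r\<^sub>0 + r) s) sums F s"
    and bound: "\<And>K. compact K \<Longrightarrow> K \<subseteq> H \<Longrightarrow> \<exists>M. summable M \<and> (\<forall>r. \<forall>s\<in>K. norm (f (r\<^sub>0 + r) s) \<le> M r)"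
  shows "locally_uniform_series H r\<^sub>0 f F"
proof -
  let ?S = "\<lambda>N s. \<Sum>r<N. f (r\<^sub>0 + r) s"
  have lim: "uniform_limit K ?S F sequentially" if K: "compact K" "K \<subseteq> H" for K
  proof -
    obtain M where M: "summable M" "\<And>r s. s \<in> K \<Longrightarrow> norm (f (r\<^sub>0 + r) s) \<le> M r"
      using bound[OF K] by blast
    have "uniform_limit K ?S (\<lambda>s. \<Sum>r. f (r\<^sub>0 + r) s) sequentially"
      using M by (rule Weierstrass_m_test[rotated])
    then show ?thesis
      by (rule uniform_limit_cong'[THEN iffD1, rotated -1])
         (use sums K(2) in \<open>auto simp: sums_iff\<close>)
  qed
  have hol_S: "?S N holomorphic_on H" for N
    by (intro holomorphic_intros hol)
  have cball: "\<exists>d>0. cball s d \<subseteq> H" if "s \<in> H" for s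
    using H that open_contains_cball by blast
  have "F holomorphic_on H"
    using H hol_S
  proof (rule holomorphic_uniform_sequence)
    fix s
    assume "s \<in> H"
    then obtain d where "d > 0" "cball s d \<subseteq> H"
      using cball by blast
    then show "\<exists>d>0. cball s d \<subseteq> H \<and> uniform_limit (cball s d) ?S F sequentially"
      using lim[OF compact_cball, of s d] by blast
  qed
  moreover have "(\<lambda>r. (deriv ^^ k) (f (r\<^sub>0 + r)) s) sums (deriv ^^ k) F s" if s: "s \<in> H" for k s
  proof -
    have deriv_S: "(deriv ^^ k) (?S N) s = (\<Sum>r<N. (deriv ^^ k) (f (r\<^sub>0 + r)) s)" for N
    proof (induction N)
      case (Suc N)
      then show ?case
        using higher_deriv_add[OF hol_S[of N] hol[of N] H s, of k] by simp
    qed (use higher_deriv_const[of k "0::complex"] in \<open>auto simp: fun_eq_iff\<close>)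
    obtain d where d: "d > 0" "cball s d \<subseteq> H"
      using cball[OF s] by blast
    have "ball s d \<subseteq> H"
      using d(2) ball_subset_cball by blast
    from holomorphic_on_subset[OF hol_S this]
    have hol_ball: "\<forall>\<^sub>F N in sequentially. ?S N holomorphic_on ball s d"
      by (intro always_eventually allI)
    have "uniform_limit (ball s d) ?S F sequentially"
      by (rule uniform_limit_on_subset[OF lim[OF compact_cball d(2)]]) auto
    then have "(\<lambda>N. (deriv ^^ k) (?S N) s) \<longlonglongrightarrow> (deriv ^^ k) F s"
      using hol_ball by (rule higher_deriv_complex_uniform_limit) (use d in auto)
    then show ?thesis
      by (simp add: sums_def deriv_S)
  qed
  moreover have "f r holomorphic_on H" if "r \<ge> r\<^sub>0" for r
    using hol[of "r - r\<^sub>0"] that by simp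
  ultimately show ?thesis
    unfolding locally_uniform_series_def using sums lim by blast
qed

subsection \<open>The moments as series\<close>

text \<open>Denominators that stay above \<open>\<delta>\<close> are comparable to those of the
  telescoping series. The statement serves both the termwise integration, with a = Re s + 1, and the
  majorants on compact sets.\<close>

lemma summable_arcsin_coeff_shift:
  fixes g :: "nat \<Rightarrow> nat" and a \<delta> :: real
  assumes g: "inj g" and \<delta>: "\<delta> > 0" "\<And>n. \<delta> \<le> real (g n) + a"
  shows "summable (\<lambda>n. arcsin_coeff k (g n) / (real (g n) + a))"
proof (rule summable_comparison_test')
  \<comment> \<open>Chosen so that \<open>real (g n) + 2\<close> is at most \<open>?K\<close> times
    \<open>real (g n) + a\<close>, by bounding |2 - a| through \<open>\<delta>\<close> and the lower
    bound on the denominators.\<close>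
  let ?K = "1 + \<bar>2 - a\<bar> / \<delta>"
  have "summable (\<lambda>n. arcsin_coeff k (g n) / (real (g n) + 2))"
    using summable_reindex[OF summable_arcsin_coeff_div g] by (simp add: o_def arcsin_coeff_nonneg)
  then show "summable (\<lambda>n. ?K * (arcsin_coeff k (g n) / (real (g n) + 2)))"
    by (rule summable_mult)
  show "norm (arcsin_coeff k (g n) / (real (g n) + a)) \<le> ?K * (arcsin_coeff k (g n) / (real (g n) + 2))" for n
  proof -
    let ?x = "real (g n) + a"
    have x: "?x > 0"
      using \<delta>(1) \<delta>(2)[of n] by linarith
    have "real (g n) + 2 \<le> ?x + \<bar>2 - a\<bar> / \<delta> * \<delta>"
      using \<delta>(1) by simp
    also have "\<dots> \<le> ?x + \<bar>2 - a\<bar> / \<delta> * ?x"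
      using \<delta> by (intro add_left_mono mult_left_mono) auto
    finally have "real (g n) + 2 \<le> ?K * ?x"
      by (simp add: algebra_simps)
    then have "1 / ?x \<le> ?K / (real (g n) + 2)"
      using x by (simp add: divide_simps)
    from mult_left_mono[OF this arcsin_coeff_nonneg[of k "g n"]] show ?thesis
      using x arcsin_coeff_nonneg[of k "g n"] by (simp add: mult_ac)
  qed
qed

lemma summable_arcsin_coeff_power_reindex:
  fixes g :: "nat \<Rightarrow> nat"
  assumes "0 \<le> x" "x < 1" "inj g"
  shows   "summable (\<lambda>n. arcsin_coeff k (g n) * x ^ g n)"
  using summable_reindex[OF summable_arcsin_coeff_power[OF assms(1,2)] assms(3)] assms(1)
  by (simp add: o_def arcsin_coeff_nonneg)

lemma arcsin_fps_sums:
  assumes "norm z < 1"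
  shows "(\<lambda>n. of_real (arcsin_coeff k (2 * n + k mod 2)) * z ^ (2 * n + k mod 2)) sums eval_fps (arcsin_fps k) z"
proof -
  have "ereal (norm z) < 1"
    using assms by simp
  then have "ereal (norm z) < fps_conv_radius (arcsin_fps k)"
    using fps_conv_radius_arcsin_fps[of k] by (rule less_le_trans)
  then have "(\<lambda>j. of_real (arcsin_coeff k j) * z ^ j) sums eval_fps (arcsin_fps k) z"
    using sums_eval_fps[of z "arcsin_fps k"] by (simp add: arcsin_fps_def)
  moreover have "of_real (arcsin_coeff k j) * z ^ j = 0" if "j \<notin> range (\<lambda>n. 2 * n + k mod 2)" for j
  proof -
    have "odd (k + j)"
    proof
      assume "even (k + j)"
      then have "j = 2 * (j div 2) + k mod 2"
        by presburger
      with that show False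
        by blast
    qed
    then show ?thesis
      by (simp add: arcsin_coeff_parity)
  qed
  ultimately show ?thesis
    by (subst sums_mono_reindex[where g = "\<lambda>n. 2 * n + k mod 2" and f = "\<lambda>j. of_real (arcsin_coeff k j) * z ^ j"])
       (auto simp: strict_mono_def)
qed

text \<open>The segment from 0 in direction \<open>u\<close> is convex and contains 0. Direction 1
  gives the real expansion and direction \<open>\<i>\<close> the hyperbolic one.\<close>

lemma arcsin_power_expansion_segment:
  fixes u :: complex
  assumes "0 \<le> x" "x < B" and u: "\<And>y. 0 \<le> y \<Longrightarrow> y < B \<Longrightarrow> norm (sin (u * of_real y)) < 1"
  shows "cos (u * of_real x) * eval_fps (arcsin_fps k) (sin (u * of_real x)) = (u * of_real x) ^ k / fact k"
proof (rule arcsin_power_expansion)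
  show "convex ((\<lambda>y. u * complex_of_real y) ` {0..<B})"
    by (intro convex_linear_image convex_real_interval
        bounded_linear.linear[OF bounded_linear_const_mult[OF bounded_linear_of_real]])
qed (use assms in auto)

text \<open>Expanding (u x)^k / k! in powers of u v(x) and dividing by u^k produces the factors
  \<open>u ^ j / u ^ k\<close>. As \<open>norm u = 1\<close>, they do not affect absolute
  convergence. The lowest exponent is \<open>k mod 2\<close>, whence the half-plane for
  \<open>s\<close>.\<close>

lemma (in increasing_substitution) arcsin_moment:
  fixes u s :: complex
  assumes u: "norm u = 1" "\<And>x. sin (u * of_real x) = u * of_real (v x)" "\<And>x. cos (u * of_real x) = of_real (v' x)"
    and v_less: "\<And>x. 0 \<le> x \<Longrightarrow> x < B \<Longrightarrow> \<bar>v x\<bar> < 1"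
    and s: "Re s > - 1 - real (k mod 2)"
    and f: "\<And>x. f x = complex_of_real (x ^ k) * complex_of_real (v x) powr s"
  defines "c \<equiv> \<lambda>n. arcsin_coeff k (2 * n + k mod 2)"
  shows "set_integrable lborel {0..B} f"
    and "(\<lambda>n. fact k * (u ^ (2 * n + k mod 2) / u ^ k) * of_real (c n) / (of_nat (2 * n + k mod 2) + s + 1)) sums
           (LBINT x:{0..B}. f x)"
proof -
  let ?d = "\<lambda>n. fact k * (u ^ (2 * n + k mod 2) / u ^ k) * complex_of_real (c n)"
  let ?g = "\<lambda>x. fact k / u ^ k * eval_fps (arcsin_fps k) (u * of_real (v x))"
  have u0: "u \<noteq> 0"
    using u(1) by auto
  have v_less': "norm (u * of_real (v x)) < 1" if "0 \<le> x" "x < B" for x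
    using that v_less[of x] u(1) by (simp add: norm_mult)
  have norm_d: "norm (?d n) = fact k * c n" for n
    using u(1) by (simp add: norm_mult norm_divide norm_power c_def arcsin_coeff_nonneg)
  have e: "real (2 * n + k mod 2) + Re s > -1" for n
    using s by simp
  have g: "(\<lambda>n. ?d n * of_real (v x) ^ (2 * n + k mod 2)) sums ?g x" if "0 < x" "x < B" for x
    using sums_mult[OF arcsin_fps_sums[OF v_less', of x k], of "fact k / u ^ k"] that
    by (simp add: c_def power_mult_distrib mult_ac)
  have abs: "summable (\<lambda>n. norm (?d n) * v x ^ (2 * n + k mod 2))" if "0 < x" "x < B" for x
  proof -
    have "summable (\<lambda>n. c n * v x ^ (2 * n + k mod 2))"
      unfolding c_def using that v_pos[of x] v_less[of x]
      by (intro summable_arcsin_coeff_power_reindex) (auto simp: inj_def)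
    from summable_mult[OF this, of "fact k"] show ?thesis
      unfolding norm_d by (simp only: mult.assoc)
  qed
  have d: "summable (\<lambda>n. norm (?d n) / (real (2 * n + k mod 2) + Re s + 1))"
  proof -
    have "summable (\<lambda>n. c n / (real (2 * n + k mod 2) + (Re s + 1)))"
      unfolding c_def using s
      by (intro summable_arcsin_coeff_shift[of _ "real (k mod 2) + Re s + 1"]) (auto simp: inj_def)
    from summable_mult[OF this, of "fact k"] show ?thesis
      unfolding norm_d by (simp only: add.assoc times_divide_eq_right)
  qed
  have f': "f x = of_real (v' x) * ?g x * of_real (v x) powr s" if "0 < x" "x < B" for x
  proof -
    have "of_real (v' x) * eval_fps (arcsin_fps k) (u * of_real (v x)) = (u * of_real x) ^ k / fact k"
      using arcsin_power_expansion_segment[of x B u k] that v_less' by (simp add: u)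
    then have "of_real (v' x) * ?g x = of_real (x ^ k)"
      using u0 by (simp add: field_simps power_mult_distrib)
    then show ?thesis
      by (simp add: f)
  qed
  note moment = power_series_moment[where d = ?d and g = ?g and f = f and s = s and e = "\<lambda>n. 2 * n + k mod 2",
      OF e g abs d f']
  show "set_integrable lborel {0..B} f"
    by (rule moment(1))
  show "(\<lambda>n. ?d n / (of_nat (2 * n + k mod 2) + s + 1)) sums (LBINT x:{0..B}. f x)"
    by (rule moment(2))
qed

lemma sin_moment:
  assumes s: "Re s > - 1 - real (k mod 2)"
  shows "set_integrable lborel {0..pi/2} (sin_integrand k s)"
    and "(\<lambda>n. fact k * of_real (arcsin_coeff k (2 * n + k mod 2)) / (of_nat (2 * n + k mod 2) + s + 1)) sums
           (LBINT x:{0..pi/2}. sin_integrand k s x)"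
proof -
  have "\<bar>sin x\<bar> < 1" if "0 \<le> x" "x < pi / 2" for x :: real
    using that sin_monotone_2pi[of x "pi / 2"] sin_ge_zero[of x] by auto
  note moment = sin_substitution.arcsin_moment[where u = 1 and f = "sin_integrand k s", OF _ _ _ this s]
  show "set_integrable lborel {0..pi/2} (sin_integrand k s)"
    by (rule moment(1)) (simp_all add: sin_integrand_def sin_of_real cos_of_real)
  show "(\<lambda>n. fact k * of_real (arcsin_coeff k (2 * n + k mod 2)) / (of_nat (2 * n + k mod 2) + s + 1)) sums
           (LBINT x:{0..pi/2}. sin_integrand k s x)"
    using moment(2) by (simp add: sin_integrand_def sin_of_real cos_of_real)
qed

lemma sinh_moment:
  assumes s: "Re s > - 1 - real (k mod 2)"
  shows "set_integrable lborel {0..arsinh 1} (sinh_integrand k s)"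
    and "(\<lambda>n. fact k * ((-1) ^ n * (-1) ^ (k div 2)) * of_real (arcsin_coeff k (2 * n + k mod 2)) /
             (of_nat (2 * n + k mod 2) + s + 1)) sums
           (LBINT x:{0..arsinh 1}. sinh_integrand k s x)"
proof -
  have "\<bar>sinh x\<bar> < 1" if "0 \<le> x" "x < arsinh 1" for x :: real
    using that sinh_real_strict_mono[THEN strict_monoD, of x "arsinh 1"] by simp
  note moment = sinh_substitution.arcsin_moment[where u = \<i> and f = "sinh_integrand k s", OF _ _ _ this s]
  have sin_i: "sin (\<i> * complex_of_real x) = \<i> * complex_of_real (sinh x)"
    and cos_i: "cos (\<i> * complex_of_real x) = complex_of_real (cosh x)" for x
    using sinh_conv_sin[of "of_real x"] cosh_conv_cos[of "of_real x"]
    by (simp_all add: sinh_field_def cosh_field_def exp_of_real flip: of_real_minus)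
  \<comment> \<open>Splitting \<open>k\<close> into quotient and remainder modulo 2 cancels the
    possible odd factor \<open>\<i>\<close>, so only real signs survive.\<close>
  have "\<i> ^ k = \<i> ^ (2 * (k div 2) + k mod 2)"
    by simp
  also have "\<dots> = (-1) ^ (k div 2) * \<i> ^ (k mod 2)"
    by (simp only: power_add power_mult power2_i)
  finally have "\<i> ^ (2 * n + k mod 2) / \<i> ^ k = (-1) ^ n * (-1) ^ (k div 2)" for n
    by (simp add: power_add power_mult divide_simps)
  note moment = moment[unfolded this]
  show "set_integrable lborel {0..arsinh 1} (sinh_integrand k s)"
    by (rule moment(1)) (simp_all add: sinh_integrand_def sin_i cos_i)
  show "(\<lambda>n. fact k * ((-1) ^ n * (-1) ^ (k div 2)) * of_real (arcsin_coeff k (2 * n + k mod 2)) /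
             (of_nat (2 * n + k mod 2) + s + 1)) sums
           (LBINT x:{0..arsinh 1}. sinh_integrand k s x)"
    by (rule moment(2)) (simp_all add: sinh_integrand_def sin_i cos_i)
qed

text \<open>One statement covers all four identities: the parity of \<open>k\<close> selects the t
  or the zeta family, \<open>e\<close> selects the indices \<open>n = 2 * r + e\<close> and with
  them the sign between the two moments, \<open>C\<close> normalises, and \<open>r\<^sub>0\<close>
  is the starting index.\<close>

lemma arcsin_moment_series:
  fixes k e r\<^sub>0 :: nat and C :: complex
  assumes e: "e < 2"
    and f: "\<And>r s. f (r\<^sub>0 + r) s = C * (of_real (arcsin_coeff k (2 * (2 * r + e) + k mod 2)) /
              (of_nat (2 * (2 * r + e) + k mod 2) + s + 1))"
    and F: "\<And>s. F s = C / (2 * fact k) * ((LBINT x:{0..pi/2}. sin_integrand k s x) +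
              (-1) ^ (e + k div 2) * (LBINT x:{0..arsinh 1}. sinh_integrand k s x))"
  shows "locally_uniform_series {s. Re s > - 1 - real (k mod 2)} r\<^sub>0 f F"
proof (rule locally_uniform_seriesI)
  let ?H = "{s. Re s > - 1 - real (k mod 2)}"
  let ?j = "\<lambda>r. 2 * (2 * r + e) + k mod 2"
  show "open ?H"
    by (rule open_halfspace_Re_gt)
  have nz: "of_nat i + s + 1 \<noteq> 0" if "s \<in> ?H" "k mod 2 \<le> i" for s i
  proof
    assume "of_nat i + s + 1 = 0"
    then have "Re (of_nat i + s + 1) = 0"
      by simp
    with that show False
      by simp
  qed
  have f_eq: "f (r\<^sub>0 + r) = (\<lambda>s. C * (of_real (arcsin_coeff k (?j r)) / (of_nat (?j r) + s + 1)))" for r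
    by (rule ext) (rule f)
  show "f (r\<^sub>0 + r) holomorphic_on ?H" for r
    unfolding f_eq by (intro holomorphic_intros nz) auto
  show "(\<lambda>r. f (r\<^sub>0 + r) s) sums F s" if "s \<in> ?H" for s
  proof -
    define T where "T n = of_real (arcsin_coeff k (2 * n + k mod 2)) / (of_nat (2 * n + k mod 2) + s + 1)" for n
    define I where "I = (LBINT x:{0..pi/2}. sin_integrand k s x)"
    define J where "J = (LBINT x:{0..arsinh 1}. sinh_integrand k s x)"
    have s: "Re s > - 1 - real (k mod 2)"
      using that by simp
    have "(\<lambda>n. fact k * T n) sums I"
      using sin_moment(2)[OF s] by (simp add: T_def I_def)
    moreover have "(\<lambda>n. fact k * ((-1) ^ n * (-1) ^ (k div 2)) * T n) sums J"
      using sinh_moment(2)[OF s] by (simp add: T_def J_def)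
    ultimately have "(\<lambda>n. C / (2 * fact k) * (fact k * T n + (-1) ^ (e + k div 2) * (fact k * ((-1) ^ n * (-1) ^ (k div 2)) * T n)))
        sums (C / (2 * fact k) * (I + (-1) ^ (e + k div 2) * J))"
      by (intro sums_mult sums_add)
    \<comment> \<open>The two moments combine with the factor 1 + (-1)^(n + e), which is 2 or 0;
      this cancels the 2 in the denominator and removes every other term.\<close>
    moreover have "C / (2 * fact k) * (fact k * T n + (-1) ^ (e + k div 2) * (fact k * ((-1) ^ n * (-1) ^ (k div 2)) * T n)) =
        (if even (n + e) then C * T n else 0)" for n
    proof -
      have "(-1) ^ (e + k div 2) * ((-1) ^ n * (-1) ^ (k div 2)) = ((-1) ^ (n + e) :: complex)"
        by (simp add: power_add)
      then have "C / (2 * fact k) * (fact k * T n + (-1) ^ (e + k div 2) * (fact k * ((-1) ^ n * (-1) ^ (k div 2)) * T n)) =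
          C / (2 * fact k) * (fact k * T n * (1 + (-1) ^ (n + e)))"
        by (simp add: algebra_simps)
      also have "\<dots> = (if even (n + e) then C * T n else 0)"
        by (simp del: even_add)
      finally show ?thesis .
    qed
    ultimately have "(\<lambda>n. if even (n + e) then C * T n else 0) sums F s"
      by (simp add: F I_def J_def)
    moreover have "n \<in> range (\<lambda>r. 2 * r + e)" if "even (n + e)" for n
    proof -
      have "n = 2 * (n div 2) + e"
        using that e by presburger
      then show ?thesis
        by blast
    qed
    ultimately have "(\<lambda>r. if even (2 * r + e + e) then C * T (2 * r + e) else 0) sums F s"
      using e by (subst sums_mono_reindex[where g = "\<lambda>r. 2 * r + e"]) (auto simp: strict_mono_def)
    then show ?thesis
      by (simp add: f T_def)
  qed
  fix K
  assume K: "compact K" "K \<subseteq> ?H"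
  \<comment> \<open>On a nonempty compact set the real part attains its minimum, which lies strictly
    inside the half-plane; replacing Re s by it gives a majorant independent of
    \<open>s\<close>.\<close>
  obtain \<sigma> where \<sigma>: "\<sigma> > - 1 - real (k mod 2)" "\<And>s. s \<in> K \<Longrightarrow> \<sigma> \<le> Re s"
  proof (cases "K = {}")
    case False
    then obtain s where "s \<in> K" "\<forall>t\<in>K. Re s \<le> Re t"
      using continuous_attains_inf[OF K(1) _ continuous_on_Re[OF continuous_on_id]] by blast
    with K(2) show ?thesis
      by (intro that[of "Re s"]) auto
  qed (use that[of 0] in auto)
  have "norm (f (r\<^sub>0 + r) s) \<le> norm C * (arcsin_coeff k (?j r) / (real (?j r) + (\<sigma> + 1)))" if "s \<in> K" for r s
  proof -
    have "real (?j r) + (\<sigma> + 1) \<le> Re (of_nat (?j r) + s + 1)"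
      using \<sigma>(2)[OF that] by simp
    also have "\<dots> \<le> norm (of_nat (?j r) + s + 1)"
      by (rule complex_Re_le_cmod)
    finally have "arcsin_coeff k (?j r) / norm (of_nat (?j r) + s + 1) \<le> arcsin_coeff k (?j r) / (real (?j r) + (\<sigma> + 1))"
      using \<sigma>(1) by (intro divide_left_mono arcsin_coeff_nonneg mult_pos_pos) auto
    then show ?thesis
      by (simp only: f norm_mult norm_divide norm_of_real abs_of_nonneg[OF arcsin_coeff_nonneg] mult_left_mono norm_ge_zero)
  qed
  moreover have "summable (\<lambda>r. arcsin_coeff k (?j r) / (real (?j r) + (\<sigma> + 1)))"
    using \<sigma>(1) by (intro summable_arcsin_coeff_shift[of _ "real (k mod 2) + \<sigma> + 1"]) (auto simp: inj_def)
  ultimately show "\<exists>M. summable M \<and> (\<forall>r. \<forall>s\<in>K. norm (f (r\<^sub>0 + r) s) \<le> M r)"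
    by (intro exI[of _ "\<lambda>r. norm C * (arcsin_coeff k (?j r) / (real (?j r) + (\<sigma> + 1)))"] conjI summable_mult) auto
qed

section \<open>Specialisation to the four identities\<close>

lemma arcsin_coeff_even_of_real:
  "(of_real (arcsin_coeff (2 * m) (2 * n)) :: 'a :: real_field) =
     of_nat ((2 * n) choose n) / 4 ^ n * of_real (t_two n m)"
  by (simp only: arcsin_coeff_even of_real_mult of_real_divide of_real_of_nat_eq of_real_power of_real_numeral)

lemma arcsin_coeff_odd_of_real:
  "(4 ^ Suc m * of_real (arcsin_coeff (2 * m + 1) (2 * n + 1)) :: 'a :: real_field) =
     2 * 4 ^ Suc n / (of_nat (Suc n) * of_nat ((2 * Suc n) choose Suc n)) * of_real (zeta_two n m)"
  using arg_cong[OF arcsin_coeff_odd[of m n], of "of_real :: real \<Rightarrow> 'a"]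
  by (simp only: of_real_mult of_real_divide of_real_of_nat_eq of_real_power of_real_numeral)

theorem theorem8p3:
  fixes m :: nat and L :: real
  assumes L: "L = arsinh 1"
  shows
    "L = ln (1 + sqrt 2) \<and>
     (\<forall>s. Re s > -1 \<longrightarrow>
        set_integrable lborel {0..pi/2} (sin_integrand (2*m) s) \<and>
        set_integrable lborel {0..L} (sinh_integrand (2*m) s)) \<and>
     locally_uniform_series {s. Re s > -1} 0
       (\<lambda>r s. of_nat ((4*r) choose (2*r)) / 16 ^ r
                * (of_real (t_two (2*r) m) / (of_nat (4*r) + s + 1)))
       (\<lambda>s. 1 / (2 * fact (2*m)) *
          ((LBINT \<theta>:{0..pi/2}. sin_integrand (2*m) s \<theta>)
            + (-1) ^ m * (LBINT t:{0..L}. sinh_integrand (2*m) s t))) \<and>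
     locally_uniform_series {s. Re s > -1} 0
       (\<lambda>r s. of_nat ((4*r+2) choose (2*r+1)) / 2 ^ (4*r+2)
                * (of_real (t_two (2*r+1) m) / (of_nat (4*r) + s + 3)))
       (\<lambda>s. 1 / (2 * fact (2*m)) *
          ((LBINT \<theta>:{0..pi/2}. sin_integrand (2*m) s \<theta>)
            - (-1) ^ m * (LBINT t:{0..L}. sinh_integrand (2*m) s t))) \<and>
     (m \<ge> 1 \<longrightarrow>
       (\<forall>s. Re s > -2 \<longrightarrow>
          set_integrable lborel {0..pi/2} (sin_integrand (2*m-1) s) \<and>
          set_integrable lborel {0..L} (sinh_integrand (2*m-1) s)) \<and>
       locally_uniform_series {s. Re s > -2} 1
         (\<lambda>r s. 16 ^ r / (of_nat r * of_nat ((4*r) choose (2*r)))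
                  * (of_real (zeta_two (2*r-1) (m-1)) / (of_nat (4*r) + s)))
         (\<lambda>s. 2 ^ (2*m-1) / fact (2*m-1) *
            ((LBINT \<theta>:{0..pi/2}. sin_integrand (2*m-1) s \<theta>)
              + (-1) ^ m * (LBINT t:{0..L}. sinh_integrand (2*m-1) s t))) \<and>
       locally_uniform_series {s. Re s > -2} 0
         (\<lambda>r s. 2 * 4 ^ (2*r+1) / (of_nat (2*r+1) * of_nat ((4*r+2) choose (2*r+1)))
                  * (of_real (zeta_two (2*r) (m-1)) / (of_nat (4*r) + s + 2)))
         (\<lambda>s. 2 ^ (2*m-1) / fact (2*m-1) *
            ((LBINT \<theta>:{0..pi/2}. sin_integrand (2*m-1) s \<theta>)
              - (-1) ^ m * (LBINT t:{0..L}. sinh_integrand (2*m-1) s t))))"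
proof (intro conjI allI impI)
  show "L = ln (1 + sqrt 2)"
    by (simp add: L arsinh_real_def)
next
  fix s :: complex
  assume "Re s > -1"
  then have s: "Re s > - 1 - real (2 * m mod 2)"
    by simp
  show "set_integrable lborel {0..pi/2} (sin_integrand (2*m) s)"
    "set_integrable lborel {0..L} (sinh_integrand (2*m) s)"
    using sin_moment(1)[OF s] sinh_moment(1)[OF s] by (simp_all add: L)
next
  show "locally_uniform_series {s. Re s > -1} 0
       (\<lambda>r s. of_nat ((4*r) choose (2*r)) / 16 ^ r
                * (of_real (t_two (2*r) m) / (of_nat (4*r) + s + 1)))
       (\<lambda>s. 1 / (2 * fact (2*m)) *
          ((LBINT \<theta>:{0..pi/2}. sin_integrand (2*m) s \<theta>)
            + (-1) ^ m * (LBINT t:{0..L}. sinh_integrand (2*m) s t)))"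
  proof -
    have "2 * (2 * r + 0) + 2 * m mod 2 = 2 * (2 * r)" for r
      by simp
    note series = arcsin_moment_series[where k = "2 * m" and e = 0 and C = 1 and r\<^sub>0 = 0, unfolded this arcsin_coeff_even_of_real]
    have "(4::complex) ^ (2 * r) = 16 ^ r" for r
      by (simp add: power_mult)
    then show ?thesis
      using series by (simp add: L)
  qed
next
  show "locally_uniform_series {s. Re s > -1} 0
       (\<lambda>r s. of_nat ((4*r+2) choose (2*r+1)) / 2 ^ (4*r+2)
                * (of_real (t_two (2*r+1) m) / (of_nat (4*r) + s + 3)))
       (\<lambda>s. 1 / (2 * fact (2*m)) *
          ((LBINT \<theta>:{0..pi/2}. sin_integrand (2*m) s \<theta>)
            - (-1) ^ m * (LBINT t:{0..L}. sinh_integrand (2*m) s t)))"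
  proof -
    have "2 * (2 * r + 1) + 2 * m mod 2 = 2 * (2 * r + 1)" for r
      by simp
    \<comment> \<open>With \<open>e = 1\<close> the sign (-1)^(1 + m) is the minus sign in front of
      the hyperbolic moment.\<close>
    note series = arcsin_moment_series[where k = "2 * m" and e = 1 and C = 1 and r\<^sub>0 = 0, unfolded this arcsin_coeff_even_of_real]
    have "(4::complex) ^ (2 * r + 1) = 2 ^ (4 * r + 2)" for r
      by (simp add: power_add power_mult)
    moreover have "2 * (2 * r + 1) = 4 * r + 2" for r :: nat
      by simp
    moreover have "of_nat (4 * r + 2) + s + 1 = of_nat (4 * r) + s + 3" for r and s :: complex
      by simp
    ultimately show ?thesis
      using series by (simp only:) (simp add: L)
  qed
next
  fix s :: complex
  assume "m \<ge> 1" "Re s > -2"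
  then obtain i where m: "m = Suc i"
    by (cases m) auto
  have s: "Re s > - 1 - real ((2 * m - 1) mod 2)"
    using \<open>Re s > -2\<close> by (simp add: m)
  show "set_integrable lborel {0..pi/2} (sin_integrand (2*m-1) s)"
    "set_integrable lborel {0..L} (sinh_integrand (2*m-1) s)"
    using sin_moment(1)[OF s] sinh_moment(1)[OF s] by (simp_all add: L)
next
  assume "m \<ge> 1"
  then obtain i where m: "m = Suc i"
    by (cases m) auto
  have k: "2 * m - 1 = 2 * i + 1" "(2 * i + 1) mod 2 = 1" "(2 * i + 1) div 2 = i" "m - 1 = i"
    by (simp_all add: m)
  \<comment> \<open>The constant \<open>4 ^ Suc i\<close> clears the power of 4 in the odd
    coefficients, and halving it yields the stated 2^(2m - 1).\<close>
  have C: "(4::complex) ^ Suc i / (2 * fact (2 * i + 1)) = 2 ^ (2 * i + 1) / fact (2 * i + 1)"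
    by (simp add: power_mult)
  have H: "- 1 - real 1 = -2"
    by simp
  note series = arcsin_moment_series[where k = "2 * i + 1" and C = "4 ^ Suc i", unfolded k C H,
      unfolded times_divide_eq_right arcsin_coeff_odd_of_real]
  show "locally_uniform_series {s. Re s > -2} 1
         (\<lambda>r s. 16 ^ r / (of_nat r * of_nat ((4*r) choose (2*r)))
                  * (of_real (zeta_two (2*r-1) (m-1)) / (of_nat (4*r) + s)))
         (\<lambda>s. 2 ^ (2*m-1) / fact (2*m-1) *
            ((LBINT \<theta>:{0..pi/2}. sin_integrand (2*m-1) s \<theta>)
              + (-1) ^ m * (LBINT t:{0..L}. sinh_integrand (2*m-1) s t)))"
    unfolding k
  \<comment> \<open>The series starts at 1, so its term of index 1 + r uses the coefficient of index
    2 (2r + 1) + 1 = 4 (1 + r) - 1. The sign (-1)^(1 + i) equals (-1)^m since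
    \<open>m = Suc i\<close>.\<close>
  proof (rule series[where e = 1])
    fix r :: nat and s :: complex
    have "(4::complex) ^ Suc (2 * r + 1) = 16 ^ (1 + r)"
      by (simp add: power_mult)
    moreover have "Suc (2 * r + 1) = 2 * (1 + r)" "2 * (2 * (1 + r)) = 4 * (1 + r)" "2 * (1 + r) - 1 = 2 * r + 1"
      by simp_all
    moreover have "of_nat (2 * (2 * r + 1) + 1) + s + 1 = of_nat (4 * (1 + r)) + s"
      by simp
    moreover have "2 * (16::complex) ^ (1 + r) / (of_nat (2 * (1 + r)) * x) = 16 ^ (1 + r) / (of_nat (1 + r) * x)" for x
      by (simp only: of_nat_mult of_nat_numeral mult.assoc) simp
    ultimately show "16 ^ (1 + r) / (of_nat (1 + r) * of_nat ((4*(1 + r)) choose (2*(1 + r))))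
                  * (of_real (zeta_two (2*(1 + r)-1) i) / (of_nat (4*(1 + r)) + s)) =
       2 * 4 ^ Suc (2 * r + 1) / (of_nat (Suc (2 * r + 1)) * of_nat ((2 * Suc (2 * r + 1)) choose Suc (2 * r + 1))) *
         of_real (zeta_two (2 * r + 1) i) / (of_nat (2 * (2 * r + 1) + 1) + s + 1)"
      by (simp only: times_divide_eq_right)
  qed (simp_all add: L m)
  show "locally_uniform_series {s. Re s > -2} 0
         (\<lambda>r s. 2 * 4 ^ (2*r+1) / (of_nat (2*r+1) * of_nat ((4*r+2) choose (2*r+1)))
                  * (of_real (zeta_two (2*r) (m-1)) / (of_nat (4*r) + s + 2)))
         (\<lambda>s. 2 ^ (2*m-1) / fact (2*m-1) *
            ((LBINT \<theta>:{0..pi/2}. sin_integrand (2*m-1) s \<theta>)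
              - (-1) ^ m * (LBINT t:{0..L}. sinh_integrand (2*m-1) s t)))"
    unfolding k
  \<comment> \<open>Now the coefficient index is 4r + 1, and the sign (-1)^i is the opposite of
    (-1)^m.\<close>
  proof (rule series[where e = 0])
    fix r :: nat and s :: complex
    have "2 * Suc (2 * r) = 4 * r + 2" "Suc (2 * r) = 2 * r + 1" "2 * r + 0 = 2 * r" "0 + r = r"
      by simp_all
    moreover have "of_nat (2 * (2 * r) + 1) + s + 1 = of_nat (4 * r) + s + 2"
      by simp
    ultimately show "2 * 4 ^ (2*(0 + r)+1) / (of_nat (2*(0 + r)+1) * of_nat ((4*(0 + r)+2) choose (2*(0 + r)+1)))
                  * (of_real (zeta_two (2*(0 + r)) i) / (of_nat (4*(0 + r)) + s + 2)) =
       2 * 4 ^ Suc (2 * r + 0) / (of_nat (Suc (2 * r + 0)) * of_nat ((2 * Suc (2 * r + 0)) choose Suc (2 * r + 0))) *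
         of_real (zeta_two (2 * r + 0) i) / (of_nat (2 * (2 * r + 0) + 1) + s + 1)"
      by (simp only: times_divide_eq_right)
  qed (simp_all add: L m)
qed

end
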